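(* Every non-affine reversible gate $G$ generates the $\mathrm{Fredkin}$ gate: $\mathrm{Fredkin}\in\langle G\rangle$.
   Context: A reversible gate (equivalently, reversible transformation) on $n\ge 1$ bits is a permutation of $\{0,1\}^n$. For a set $S$ of reversible gates (possibly on different numbers of bits), $\langle S\rangle$ is the smallest set of reversible transformations such that: (1) it contains $S$ and the identity on $\{0,1\}^n$ for all $n\ge1$; (2) if it contains $F$ and $G$ on $n$ bits, it contains $F\circ G$; (3) if it contains $F$ on $n$ bits, it contains every function obtained from $F$ by permuting its input bits and permuting its output bits; (4) if it contains $F$ on $n$ bits, it contains the $(n+1)$-bit map $(x,b)\mapsto(F(x),b)$; (5) (ancilla rule) if it contains $F$ on $n+k$ bits and there are a fixed string $a\in\{0,1\}^k$ and an $n$-bit transformation $G$ with $F(x,a)=(G(x),a)$ for all $x\in\{0,1\}^n$, then it contains $G$. $\langle G\rangle=\langle\{G\}\rangle$. A gate is affine if it has the form $x\mapsto Ax\oplus b$ with $A$ an invertible matrix over $\mathbb{F}_2$ and $b$ a vector over $\mathbb{F}_2$; otherwise it is non-affine. $\mathrm{Fredkin}$ is the 3-bit gate on $(x,y,z)$ that swaps $y$ and $z$ if $x=1$ and does nothing if $x=0$. *)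

theory Defs
  imports
    "HOL-Library.Z2"
    "HOL-Combinatorics.Permutations"
    "Jordan_Normal_Form.Matrix"
begin

definition bit_strings :: "nat \<Rightarrow> bit list set" where
  "bit_strings n = {xs. length xs = n}"

text \<open>A gate is a pair of a number \<open>n\<close> of bits and a permutation of the bit strings of length
  \<open>n\<close>. By the convention of \<open>permutes\<close> the permutation is the identity on lists of any
  other length, so two gates are equal iff they have the same number of bits and agree on all
  their inputs.\<close>

type_synonym gate = "nat \<times> (bit list \<Rightarrow> bit list)"

definition reversible :: "nat \<Rightarrow> (bit list \<Rightarrow> bit list) \<Rightarrow> bool" where
  "reversible n F \<longleftrightarrow> 1 \<le> n \<and> F permutes bit_strings n"

text \<open>In the rules \<open>permute\<close>, \<open>extend\<close> and \<open>ancilla\<close> the new map \<open>G\<close> is given by its values on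
  the bit strings of the relevant length; the premise that \<open>G\<close> is \<open>reversible\<close> fixes it elsewhere.\<close>

inductive_set generated :: "gate set \<Rightarrow> gate set" for S :: "gate set" where
  base: "(n, F) \<in> S \<Longrightarrow> (n, F) \<in> generated S"
| ident: "1 \<le> n \<Longrightarrow> (n, id) \<in> generated S"
| compose: "(n, F) \<in> generated S \<Longrightarrow> (n, G) \<in> generated S \<Longrightarrow> (n, F \<circ> G) \<in> generated S"
| permute: "(n, F) \<in> generated S \<Longrightarrow> \<sigma> permutes {..<n} \<Longrightarrow> \<tau> permutes {..<n} \<Longrightarrow>
    reversible n G \<Longrightarrow>
    (\<And>x. x \<in> bit_strings n \<Longrightarrow> G x = permute_list \<tau> (F (permute_list \<sigma> x))) \<Longrightarrow>
    (n, G) \<in> generated S"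
| extend: "(n, F) \<in> generated S \<Longrightarrow> reversible (n + 1) G \<Longrightarrow>
    (\<And>x b. x \<in> bit_strings n \<Longrightarrow> G (x @ [b]) = F x @ [b]) \<Longrightarrow>
    (n + 1, G) \<in> generated S"
| ancilla: "(n + k, F) \<in> generated S \<Longrightarrow> a \<in> bit_strings k \<Longrightarrow> reversible n G \<Longrightarrow>
    (\<And>x. x \<in> bit_strings n \<Longrightarrow> F (x @ a) = G x @ a) \<Longrightarrow>
    (n, G) \<in> generated S"

definition affine_gate :: "nat \<Rightarrow> (bit list \<Rightarrow> bit list) \<Rightarrow> bool" where
  "affine_gate n F \<longleftrightarrow>
    (\<exists>A \<in> carrier_mat n n. \<exists>b \<in> carrier_vec n. invertible_mat A \<and>
      (\<forall>x \<in> bit_strings n. vec_of_list (F x) = A *\<^sub>v vec_of_list x + b))"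

fun fredkin :: "bit list \<Rightarrow> bit list" where
  "fredkin [x, y, z] = (if x = 1 then [x, z, y] else [x, y, z])"
| "fredkin xs = xs"

lemma reversible_fredkin: "reversible 3 fredkin"
proof -
  have inv: "fredkin (fredkin xs) = xs" for xs
    by (cases xs rule: fredkin.cases) auto
  have "bij_betw fredkin (bit_strings 3) (bit_strings 3)"
  proof (rule bij_betw_byWitness[where f' = fredkin])
    show "fredkin ` bit_strings 3 \<subseteq> bit_strings 3"
    proof clarify
      fix xs assume "xs \<in> bit_strings 3"
      then show "fredkin xs \<in> bit_strings 3"
        by (cases xs rule: fredkin.cases) (auto simp: bit_strings_def)
    qed
    then show "fredkin ` bit_strings 3 \<subseteq> bit_strings 3" .
  qed (use inv in auto)
  moreover have "fredkin xs = xs" if "xs \<notin> bit_strings 3" for xs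
    using that by (cases xs rule: fredkin.cases) (auto simp: bit_strings_def)
  ultimately show ?thesis
    by (auto simp: reversible_def intro: bij_imp_permutes)
qed

lemma reversible_generated:
  assumes "(n, F) \<in> generated S" "\<And>m G. (m, G) \<in> S \<Longrightarrow> reversible m G"
  shows "reversible n F"
  using assms(1)
proof (induction n F rule: generated.induct)
  case (base n F)
  then show ?case using assms(2) by blast
next
  case (ident n)
  then show ?case by (simp only: reversible_def permutes_id simp_thms)
next
  case (compose n F G)
  then show ?case unfolding reversible_def by (blast intro: permutes_compose)
qed

end

theory Submission
  imports Defs "Jordan_Normal_Form.Determinant"
begin

text \<open>Regard wires as functions from inputs to bits. The applications of \<open>G\<close> generate a congruence
  \<open>\<approx>\<close> on multisets of wires, in which constants (ancillas) may be cancelled; the task is to relate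
  \<open>{X, Y, Z}\<close> to its image under the Fredkin gate.

  Some face of the cube carries an output bit of degree 2. Hence some edge flips two output bits, so \<open>G\<close> is
  not monotone either (a monotone bijection preserves the Hamming weight). Running \<open>G\<close> along the edge
  copies a wire up to constants, and compute-copy-uncompute then shows that any wires separating the
  inputs may create and erase an encoding of every Boolean function. Arbitrary catalysts may therefore
  be cancelled as well, which reduces the problem to the stable equivalence \<open>\<approx>\<^sub>s\<close>, effectively an
  abelian group.

  There, change the wires at a single input \<open>d\<close> in two ways such that the outputs of \<open>G\<close> at \<open>d\<close>
  differ in one bit only. With \<open>[f]\<close> the class of \<open>f\<close> and \<open>\<psi> f = [f(d := 1)] - [f(d := 0)]\<close>, this gives
  \<open>\<psi> (g s t) = c\<^sub>1 \<psi> s + c\<^sub>2 \<psi> t + const\<close> with \<open>c\<^sub>1, c\<^sub>2\<close> in \<open>{-1, 0, 1}\<close> and \<open>g\<close> of degree 2. As \<open>g\<close>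
  becomes constant for a suitable constant value of either argument, \<open>\<psi>\<close> is constant, so two wires may
  exchange their values at \<open>d\<close>. The Fredkin gate exchanges \<open>Y\<close> and \<open>Z\<close> at two inputs.\<close>

section \<open>Bijections of the Boolean cube\<close>

text \<open>If no bit ever falls, injectivity makes the cardinality of \<open>\<phi> T\<close> grow
  strictly along every edge, hence \<open>card T \<le> card (\<phi> T)\<close>. The sums over all
  subsets agree, so equality holds throughout and each edge adds exactly one element, which excludes
  a double flip.\<close>

lemma subset_bijection_not_monotone:
  assumes "finite N" and bij: "bij_betw \<phi> (Pow N) (Pow N)"
    and S: "S \<subseteq> N" "j \<in> N - S"
    and flips: "a \<noteq> b" "(a \<in> \<phi> S) \<noteq> (a \<in> \<phi> (insert j S))" "(b \<in> \<phi> S) \<noteq> (b \<in> \<phi> (insert j S))"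
  obtains T k i where "T \<subseteq> N" "k \<in> N - T" "i \<in> \<phi> T" "i \<notin> \<phi> (insert k T)"
proof (rule ccontr)
  note goal = that
  assume "\<not> thesis"
  have mono: "\<phi> T \<subseteq> \<phi> (insert k T)" if "T \<subseteq> N" "k \<in> N - T" for T k
    using that goal \<open>\<not> thesis\<close> by blast
  have psub: "\<phi> T \<subset> \<phi> (insert k T)" if "T \<subseteq> N" "k \<in> N - T" for T k
  proof -
    have "\<phi> T \<noteq> \<phi> (insert k T)"
      using bij that unfolding bij_betw_def inj_on_def by blast
    then show ?thesis using mono[OF that] by blast
  qed
  have im: "\<phi> T \<subseteq> N" if "T \<subseteq> N" for T
    using bij that unfolding bij_betw_def by blast
  have fin: "finite (\<phi> T)" if "T \<subseteq> N" for T
    using im[OF that] \<open>finite N\<close> finite_subset by blast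
  have le: "card T \<le> card (\<phi> T)" if "T \<subseteq> N" for T
  proof -
    from that have "finite T" using \<open>finite N\<close> finite_subset by blast
    then show ?thesis using that
    proof (induction T rule: finite_induct)
      case (insert k T)
      then have "card (\<phi> T) < card (\<phi> (insert k T))"
        by (intro psubset_card_mono psub fin) auto
      with insert show ?case by auto
    qed simp
  qed
  have "(\<Sum>T\<in>Pow N. card (\<phi> T)) = (\<Sum>T\<in>Pow N. card T)"
    by (rule sum.reindex_bij_betw[OF bij])
  then have eq: "card (\<phi> T) = card T" if "T \<subseteq> N" for T
    using sum_mono_inv[of card "Pow N" "\<lambda>T. card (\<phi> T)" T] le that \<open>finite N\<close> by auto
  have "finite S" using S \<open>finite N\<close> finite_subset by blast
  have sub: "\<phi> S \<subseteq> \<phi> (insert j S)" using mono S by blast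
  have "card (\<phi> (insert j S) - \<phi> S) = card (\<phi> (insert j S)) - card (\<phi> S)"
    using sub fin S by (intro card_Diff_subset) auto
  also have "\<dots> = 1" using eq S \<open>finite S\<close> by auto
  finally obtain x where "\<phi> (insert j S) - \<phi> S = {x}"
    by (rule card_1_singletonE)
  moreover have "a \<in> \<phi> (insert j S) - \<phi> S" "b \<in> \<phi> (insert j S) - \<phi> S"
    using flips sub by auto
  ultimately show False using flips(1) by (metis singletonD)
qed

text \<open>On an odd square, membership of \<open>i\<close> singles out one corner. If each edge
  flipped at most one bit, the images of the two neighbours of that corner would both differ from
  its image in \<open>i\<close> alone, hence coincide, against injectivity.\<close>

lemma two_flips_of_odd_square:
  assumes inj: "inj_on \<phi> (Pow N)" and S: "S \<subseteq> N" "j \<in> N - S" "k \<in> N - S" "j \<noteq> k"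
    and odd: "((i \<in> \<phi> S) = (i \<in> \<phi> (insert j S))) \<noteq> ((i \<in> \<phi> (insert k S)) = (i \<in> \<phi> (insert k (insert j S))))"
  obtains T l a b where "T \<subseteq> N" "l \<in> N - T" "a \<noteq> b"
    "(a \<in> \<phi> T) \<noteq> (a \<in> \<phi> (insert l T))" "(b \<in> \<phi> T) \<noteq> (b \<in> \<phi> (insert l T))"
proof (rule ccontr)
  note goal = that
  assume "\<not> thesis"
  have one: "a = b" if "T \<subseteq> N" "l \<in> N - T"
    "(a \<in> \<phi> T) \<noteq> (a \<in> \<phi> (insert l T))" "(b \<in> \<phi> T) \<noteq> (b \<in> \<phi> (insert l T))" for T l a b
    using that goal \<open>\<not> thesis\<close> by blast
  have swap: "insert j (insert k S) = insert k (insert j S)" by auto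
  have e1: "(i \<in> \<phi> S) = (i \<in> \<phi> (insert j S))
      \<or> (x \<in> \<phi> S) = (x \<in> \<phi> (insert j S))"
    and e2: "(i \<in> \<phi> S) = (i \<in> \<phi> (insert k S))
      \<or> (x \<in> \<phi> S) = (x \<in> \<phi> (insert k S))"
    and e3: "(i \<in> \<phi> (insert j S)) = (i \<in> \<phi> (insert k (insert j S)))
      \<or> (x \<in> \<phi> (insert j S)) = (x \<in> \<phi> (insert k (insert j S)))"
    and e4: "(i \<in> \<phi> (insert k S)) = (i \<in> \<phi> (insert k (insert j S)))
      \<or> (x \<in> \<phi> (insert k S)) = (x \<in> \<phi> (insert k (insert j S)))"
    if "x \<noteq> i" for x
    using one[of S j i x] one[of S k i x] one[of "insert j S" k i x]
      one[of "insert k S" j i x, unfolded swap] S that by auto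
  have ne: "\<phi> S \<noteq> \<phi> (insert k (insert j S))" "\<phi> (insert j S) \<noteq> \<phi> (insert k S)"
    using inj S unfolding inj_on_def by (metis Diff_iff PowI insert_subset insertI1 insertE)+
  show False
  \<comment> \<open>In the first case the odd corner is \<open>S\<close> or the one opposite to it,
    so its neighbours are \<open>insert j S\<close> and \<open>insert k S\<close>.\<close>
  proof (cases "(i \<in> \<phi> (insert j S)) = (i \<in> \<phi> (insert k S))")
    case True
    have "\<phi> (insert j S) = \<phi> (insert k S)"
    proof (rule Set.set_eqI)
      fix x show "x \<in> \<phi> (insert j S) \<longleftrightarrow> x \<in> \<phi> (insert k S)"
        using e1[of x] e2[of x] e3[of x] e4[of x] True odd by (smt (verit))
    qed
    with ne show ?thesis by simp
  next
    case False
    have "\<phi> S = \<phi> (insert k (insert j S))"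
    proof (rule Set.set_eqI)
      fix x show "x \<in> \<phi> S \<longleftrightarrow> x \<in> \<phi> (insert k (insert j S))"
        using e1[of x] e2[of x] e3[of x] e4[of x] False odd by (smt (verit))
    qed
    with ne show ?thesis by simp
  qed
qed

section \<open>Bit strings as subsets, and affinity from vanishing second differences\<close>

definition bits_of_set :: "nat \<Rightarrow> nat set \<Rightarrow> bit list" where
  "bits_of_set n S = map (\<lambda>i. of_bool (i \<in> S)) [0..<n]"

definition set_of_bits :: "bit list \<Rightarrow> nat set" where
  "set_of_bits x = {i. i < length x \<and> x ! i = 1}"

lemma length_bits_of_set [simp]: "length (bits_of_set n S) = n"
  by (simp add: bits_of_set_def)

lemma nth_bits_of_set [simp]: "i < n \<Longrightarrow> bits_of_set n S ! i = of_bool (i \<in> S)"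
  by (simp add: bits_of_set_def)

lemma bits_of_set_of_bits: "length x = n \<Longrightarrow> bits_of_set n (set_of_bits x) = x"
  by (auto simp: set_of_bits_def intro!: nth_equalityI)

lemma set_of_bits_of_set: "S \<subseteq> {..<n} \<Longrightarrow> set_of_bits (bits_of_set n S) = S"
  by (auto simp: set_of_bits_def split: if_splits)

lemma bij_betw_bits_of_set: "bij_betw (bits_of_set n) (Pow {..<n}) (bit_strings n)"
  by (rule bij_betw_byWitness[where f' = set_of_bits])
    (auto simp: set_of_bits_of_set bits_of_set_of_bits bit_strings_def, auto simp: set_of_bits_def)

lemma bij_betw_set_of_bits: "bij_betw set_of_bits (bit_strings n) (Pow {..<n})"
  by (rule bij_betw_byWitness[where f' = "bits_of_set n"])
    (auto simp: set_of_bits_of_set bits_of_set_of_bits bit_strings_def, auto simp: set_of_bits_def)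

lemma finite_bit_strings: "finite (bit_strings n)"
  using bij_betw_finite[OF bij_betw_set_of_bits] by simp

text \<open>The change of an output bit along direction \<open>k\<close> does not depend on the base
  point, so adding up these changes gives an affine form. The matrix is invertible because
  \<open>G\<close> is onto.\<close>

lemma affine_gateI:
  assumes rev: "reversible n G"
    and diff: "\<And>S j k i. \<lbrakk>S \<subseteq> {..<n}; j \<in> {..<n} - S; k \<in> {..<n} - S; j \<noteq> k; i < n\<rbrakk> \<Longrightarrow>
      G (bits_of_set n S) ! i + G (bits_of_set n (insert j S)) ! i =
      G (bits_of_set n (insert k S)) ! i + G (bits_of_set n (insert k (insert j S))) ! i"
  shows "affine_gate n G"
proof -
  let ?g = "\<lambda>S i. G (bits_of_set n S) ! i"
  define a where "a i k = ?g {} i + ?g {k} i" for i k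
  have len: "length (G x) = n" if "length x = n" for x
    using rev that permutes_in_image[of G "bit_strings n" x] by (auto simp: reversible_def bit_strings_def)
  have bij: "bij_betw G (bit_strings n) (bit_strings n)"
    using rev by (auto simp: reversible_def permutes_imp_bij)
  have step: "?g T i + ?g (insert k T) i = a i k" if "T \<subseteq> {..<n}" "k \<in> {..<n} - T" "i < n" for T k i
  proof -
    from that have "finite T" using finite_subset by blast
    then show ?thesis using that
    proof (induction T rule: finite_induct)
      case empty
      then show ?case by (simp add: a_def)
    next
      case (insert j T)
      then show ?case using diff[of T k j i] by (auto simp: insert_commute)
    qed
  qed
  have total: "?g T i = (\<Sum>k\<in>T. a i k) + ?g {} i" if "T \<subseteq> {..<n}" "i < n" for T i
  proof -
    from that have "finite T" using finite_subset by blast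
    then show ?thesis using that
    proof (induction T rule: finite_induct)
      case (insert j T)
      have "?g (insert j T) i = a i j + ?g T i"
        using step[of T j i] insert by (cases "?g T i"; cases "?g (insert j T) i") auto
      moreover have "?g T i = sum (a i) T + ?g {} i"
        by (rule insert.IH) (use insert.prems in auto)
      moreover have "sum (a i) (insert j T) = a i j + sum (a i) T"
        using insert(1,2) by (rule sum.insert)
      ultimately show ?case by (simp only: add.assoc)
    qed simp
  qed
  define A where "A = mat n n (\<lambda>(i, k). a i k)"
  define b where "b = vec_of_list (G (bits_of_set n {}))"
  have A: "A \<in> carrier_mat n n" by (simp add: A_def)
  have b: "b \<in> carrier_vec n"
    by (rule carrier_vecI) (simp add: b_def len)
  have affine: "vec_of_list (G x) = A *\<^sub>v vec_of_list x + b" if x: "x \<in> bit_strings n" for x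
  proof (rule eq_vecI)
    have lx: "length x = n" using x by (simp add: bit_strings_def)
    fix i assume "i < dim_vec (A *\<^sub>v vec_of_list x + b)"
    then have i: "i < n" using b by simp
    have "(\<Sum>k\<in>set_of_bits x. a i k) = (\<Sum>k\<in>{0..<n}. a i k * x ! k)"
      by (rule sum.mono_neutral_cong_left) (auto simp: set_of_bits_def lx)
    moreover have "set_of_bits x \<subseteq> {..<n}" using lx by (auto simp: set_of_bits_def)
    ultimately show "vec_of_list (G x) $ i = (A *\<^sub>v vec_of_list x + b) $ i"
      using total[of "set_of_bits x" i] i lx A b
      by (simp add: vec_of_list_index bits_of_set_of_bits A_def b_def scalar_prod_def len)
  qed (use x A b len in \<open>auto simp: bit_strings_def\<close>)
  \<comment> \<open>Preimages of the shifted unit vectors will be the columns of a right inverse of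
    \<open>A\<close>.\<close>
  have "\<exists>y. y \<in> bit_strings n \<and> G y = list_of_vec (unit_vec n j + b)" if "j < n" for j
  proof -
    have "list_of_vec (unit_vec n j + b) \<in> bit_strings n"
      using b by (simp add: bit_strings_def list_of_vec_map)
    then show ?thesis using bij unfolding bij_betw_def by (metis imageE)
  qed
  then obtain y where y: "\<And>j. j < n \<Longrightarrow> y j \<in> bit_strings n"
    "\<And>j. j < n \<Longrightarrow> G (y j) = list_of_vec (unit_vec n j + b)"
    by metis
  define B where "B = mat n n (\<lambda>(i, j). y j ! i)"
  have B: "B \<in> carrier_mat n n" by (simp add: B_def)
  have colB: "col B j = vec_of_list (y j)" if "j < n" for j
    using that y(1)[OF that] by (intro eq_vecI) (auto simp: B_def vec_of_list_index bit_strings_def)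
  have "A * B = 1\<^sub>m n"
  proof (rule eq_matI)
    fix i j assume "i < dim_row (1\<^sub>m n :: bit mat)" "j < dim_col (1\<^sub>m n :: bit mat)"
    then have ij: "i < n" "j < n" by auto
    have "(A *\<^sub>v vec_of_list (y j) + b) $ i = (unit_vec n j + b) $ i"
      using affine[OF y(1)] y(2) ij by (simp add: vec_list)
    then have "(A *\<^sub>v vec_of_list (y j)) $ i + b $ i = unit_vec n j $ i + b $ i"
      using ij A b by (simp del: add_bit_eq_xor)
    then have "(A *\<^sub>v vec_of_list (y j)) $ i = unit_vec n j $ i"
      by (simp only: add_right_cancel)
    then show "(A * B) $$ (i, j) = 1\<^sub>m n $$ (i, j)"
      using ij A B by (simp add: colB unit_vec_def)
  qed (use A B in auto)
  then have "invertible_mat A"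
    using mat_mult_left_right_inverse[OF A B] A B
    by (auto simp: invertible_mat_def inverts_mat_def intro!: exI[of _ B])
  with A b affine show ?thesis unfolding affine_gate_def by blast
qed

section \<open>Circuits and multisets of wires\<close>

locale reversible_gate =
  fixes n :: nat and G :: "bit list \<Rightarrow> bit list"
  assumes rev: "reversible n G"
begin

abbreviation gen :: "gate set" where "gen \<equiv> generated {(n, G)}"

lemma gen_reversible: "(m, F) \<in> gen \<Longrightarrow> reversible m F"
  using reversible_generated[of m F "{(n, G)}"] rev by blast

lemma gen_length:
  assumes "(m, F) \<in> gen" "length x = m"
  shows "length (F x) = m"
  using permutes_in_image[of F "bit_strings m" x] gen_reversible[OF assms(1)] assms(2)
  by (auto simp: reversible_def bit_strings_def)

lemma G_length: "length x = n \<Longrightarrow> length (G x) = n"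
  by (rule gen_length[OF generated.base]) simp_all

text \<open>The closure rules contain no inversion, but the powers of \<open>F\<close> lie in a
  finite group, so two of them coincide and cancelling exhibits the inverse as a power.\<close>

lemma gen_inv:
  assumes "(m, F) \<in> gen"
  shows "(m, inv_into UNIV F) \<in> gen"
proof -
  have perm: "F permutes bit_strings m" and m: "1 \<le> m"
    using gen_reversible[OF assms] by (auto simp: reversible_def)
  have pow: "(m, F ^^ k) \<in> gen" for k
    by (induction k)
      (simp_all only: funpow.simps generated.ident[OF m] generated.compose[OF assms])
  have "range (\<lambda>k. F ^^ k) \<subseteq> {p. p permutes bit_strings m}"
    using gen_reversible[OF pow] by (auto simp: reversible_def)
  then have "finite (range (\<lambda>k. F ^^ k))"
    using finite_permutations[OF finite_bit_strings] finite_subset by blast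
  then have "\<not> inj (\<lambda>k. F ^^ k)"
    using finite_imageD infinite_UNIV_nat by blast
  then obtain a b where ab: "a < b" "F ^^ a = F ^^ b"
    unfolding inj_def by (metis linorder_neqE_nat)
  then obtain k where "b = a + Suc k" by (metis less_imp_Suc_add add_Suc_right)
  with ab have "F ^^ a \<circ> id = F ^^ a \<circ> (F ^^ Suc k)" by (metis funpow_add comp_id)
  moreover have "inj (F ^^ a)"
    using gen_reversible[OF pow] by (auto simp: reversible_def intro: permutes_inj)
  ultimately have "id = F \<circ> F ^^ k" by (simp add: fun.inj_map_strong inj_def fun_eq_iff)
  then have "inv_into UNIV F = F ^^ k"
    by (metis comp_id o_assoc permutes_inv_o(2)[OF perm] id_comp)
  with pow show ?thesis by simp
qed

text \<open>A wire carries a function on a domain \<open>'d\<close>, its values on all inputs under consideration.\<close>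

definition circuit :: "('d \<Rightarrow> bit) list \<Rightarrow> ('d \<Rightarrow> bit) list \<Rightarrow> bool" where
  "circuit fs gs \<longleftrightarrow> length gs = length fs \<and>
    (\<exists>F. (length fs, F) \<in> gen \<and> (\<forall>d. F (map (\<lambda>f. f d) fs) = map (\<lambda>f. f d) gs))"

lemma circuit_trans: "circuit fs gs \<Longrightarrow> circuit gs hs \<Longrightarrow> circuit fs hs"
  unfolding circuit_def by (metis comp_apply generated.compose)

lemma circuit_sym:
  assumes "circuit fs gs"
  shows "circuit gs fs"
proof -
  obtain F where len: "length gs = length fs" and F: "(length fs, F) \<in> gen"
    "\<And>d. F (map (\<lambda>f. f d) fs) = map (\<lambda>f. f d) gs"
    using assms unfolding circuit_def by blast
  have "inj F" using gen_reversible[OF F(1)] by (auto simp: reversible_def intro: permutes_inj)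
  then have "inv_into UNIV F (map (\<lambda>f. f d) gs) = map (\<lambda>f. f d) fs" for d
    by (metis F(2) inv_f_f)
  with len gen_inv[OF F(1)] show ?thesis unfolding circuit_def by auto
qed

text \<open>This makes the order of the wires immaterial and so justifies passing to
  multisets.\<close>

lemma circuit_perm:
  assumes "mset gs = mset fs" "fs \<noteq> []"
  shows "circuit fs gs"
proof -
  let ?m = "length fs"
  obtain p where p: "p permutes {..<?m}" "permute_list p fs = gs"
    using mset_eq_permutation[OF assms(1)] by blast
  define F where "F = (\<lambda>x :: bit list. if length x = ?m then permute_list p x else x)"
  have "bij_betw F (bit_strings ?m) (bit_strings ?m)"
  proof (rule bij_betw_byWitness[where f' = "permute_list (inv_into UNIV p)"])
    have inv: "inv_into UNIV p permutes {..<?m}" using p(1) by (rule permutes_inv)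
    show "\<forall>x\<in>bit_strings ?m. permute_list (inv_into UNIV p) (F x) = x"
    proof
      fix x assume "x \<in> bit_strings ?m"
      then show "permute_list (inv_into UNIV p) (F x) = x"
        using permute_list_compose[of "inv_into UNIV p" x p] p(1) inv
        by (simp add: F_def bit_strings_def permutes_inv_o)
    qed
    show "\<forall>x\<in>bit_strings ?m. F (permute_list (inv_into UNIV p) x) = x"
    proof
      fix x assume "x \<in> bit_strings ?m"
      then show "F (permute_list (inv_into UNIV p) x) = x"
        using permute_list_compose[of p x "inv_into UNIV p"] p(1)
        by (simp add: F_def bit_strings_def permutes_inv_o)
    qed
  qed (auto simp: F_def bit_strings_def)
  then have "F permutes bit_strings ?m"
    by (rule bij_imp_permutes) (auto simp: F_def bit_strings_def)
  then have "reversible ?m F"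
    using assms(2) by (simp add: reversible_def Suc_le_eq)
  then have "(?m, F) \<in> gen"
  proof (rule generated.permute[where F = id and \<sigma> = p and \<tau> = id, rotated 3])
    show "(?m, id) \<in> gen" using assms(2) by (simp add: generated.ident Suc_le_eq)
  qed (use p in \<open>auto simp: F_def bit_strings_def permutes_id\<close>)
  moreover have "F (map (\<lambda>f. f d) fs) = map (\<lambda>f. f d) gs" for d
    using p by (auto simp: F_def permute_list_map)
  ultimately show ?thesis
    using mset_eq_length[OF assms(1)] unfolding circuit_def by blast
qed

lemma circuit_append1:
  assumes "circuit fs gs"
  shows "circuit (fs @ [h]) (gs @ [h])"
proof -
  let ?m = "length fs"
  obtain F where len: "length gs = ?m" and F: "(?m, F) \<in> gen"
    "\<And>d. F (map (\<lambda>f. f d) fs) = map (\<lambda>f. f d) gs"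
    using assms unfolding circuit_def by blast
  have perm: "F permutes bit_strings ?m" using gen_reversible[OF F(1)] by (simp add: reversible_def)
  define H where "H = (\<lambda>x. if length x = ?m + 1 then F (butlast x) @ [last x] else x)"
  have "bij_betw H (bit_strings (?m + 1)) (bit_strings (?m + 1))"
  proof (rule bij_betw_byWitness[where f' = "\<lambda>x. inv_into UNIV F (butlast x) @ [last x]"])
    have "length (F (butlast x)) = ?m" "length (inv_into UNIV F (butlast x)) = ?m" if "length x = ?m + 1" for x
      using that gen_length[OF F(1), of "butlast x"] gen_length[OF gen_inv[OF F(1)], of "butlast x"]
      by auto
    then show "H ` bit_strings (?m + 1) \<subseteq> bit_strings (?m + 1)"
      "(\<lambda>x. inv_into UNIV F (butlast x) @ [last x]) ` bit_strings (?m + 1) \<subseteq> bit_strings (?m + 1)"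
      by (auto simp: H_def bit_strings_def)
    show "\<forall>x\<in>bit_strings (?m + 1). H (inv_into UNIV F (butlast x) @ [last x]) = x"
      "\<forall>x\<in>bit_strings (?m + 1). inv_into UNIV F (butlast (H x)) @ [last (H x)] = x"
      using permutes_inverses[OF perm] gen_length[OF gen_inv[OF F(1)]]
      by (auto simp: H_def bit_strings_def length_Suc_conv_rev)
  qed
  then have "H permutes bit_strings (?m + 1)"
    by (rule bij_imp_permutes) (auto simp: H_def bit_strings_def)
  then have "reversible (?m + 1) H" by (simp add: reversible_def)
  then have "(?m + 1, H) \<in> gen"
    by (intro generated.extend[OF F(1)]) (auto simp: H_def bit_strings_def)
  moreover have "H (map (\<lambda>f. f d) (fs @ [h])) = map (\<lambda>f. f d) (gs @ [h])" for d
    by (simp add: H_def F(2))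
  ultimately show ?thesis
    using len unfolding circuit_def by (intro conjI exI[of _ H]) auto
qed

lemma circuit_append: "circuit fs gs \<Longrightarrow> circuit (fs @ hs) (gs @ hs)"
proof (induction hs rule: rev_induct)
  case (snoc h hs)
  then show ?case using circuit_append1[of "fs @ hs" "gs @ hs" h] by simp
qed simp

section \<open>The congruence on multisets of wires and its soundness\<close>

definition gate_outputs :: "('d \<Rightarrow> bit) list \<Rightarrow> ('d \<Rightarrow> bit) list" where
  "gate_outputs fs = map (\<lambda>i d. G (map (\<lambda>f. f d) fs) ! i) [0..<n]"

lemma circuit_gate: "length fs = n \<Longrightarrow> circuit fs (gate_outputs fs)"
  unfolding circuit_def gate_outputs_def
  by (intro conjI exI[of _ G]) (auto intro!: generated.base nth_equalityI simp: G_length)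

text \<open>Each rule is sound for circuits: \<open>sym\<close> because gates can be inverted,
  \<open>cancel_const\<close> because a constant wire that is returned unchanged is an
  ancilla.\<close>

inductive eqv :: "('d \<Rightarrow> bit) multiset \<Rightarrow> ('d \<Rightarrow> bit) multiset \<Rightarrow> bool" (infix "\<approx>" 50) where
  refl: "M \<approx> M"
| sym: "M \<approx> N \<Longrightarrow> N \<approx> M"
| trans: "L \<approx> M \<Longrightarrow> M \<approx> N \<Longrightarrow> L \<approx> N"
| add: "M \<approx> N \<Longrightarrow> M + L \<approx> N + L"
| cancel_const: "M + {#\<lambda>_. b#} \<approx> N + {#\<lambda>_. b#} \<Longrightarrow> M \<approx> N"
| gate: "length fs = n \<Longrightarrow> mset fs \<approx> mset (gate_outputs fs)"

definition all_const :: "('d \<Rightarrow> bit) multiset \<Rightarrow> bool" where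
  "all_const C \<longleftrightarrow> (\<forall>f\<in>#C. \<exists>b. f = (\<lambda>_. b))"

lemma all_const_simps [simp]:
  "all_const {#}" "all_const {#\<lambda>_. b#}" "all_const (C + D) \<longleftrightarrow> all_const C \<and> all_const D"
  "all_const (add_mset f C) \<longleftrightarrow> (\<exists>b. f = (\<lambda>_. b)) \<and> all_const C"
  by (auto simp: all_const_def)

definition mcircuit :: "('d \<Rightarrow> bit) multiset \<Rightarrow> ('d \<Rightarrow> bit) multiset \<Rightarrow> bool" where
  "mcircuit M N \<longleftrightarrow> M \<noteq> {#} \<and> (\<forall>fs gs. mset fs = M \<longrightarrow> mset gs = N \<longrightarrow> circuit fs gs)"

lemma mcircuitI:
  assumes "circuit fs gs" "fs \<noteq> []"
  shows "mcircuit (mset fs) (mset gs)"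
  unfolding mcircuit_def
proof (intro conjI allI impI)
  fix fs' gs' assume eq: "mset fs' = mset fs" "mset gs' = mset gs"
  have "gs \<noteq> []" "fs' \<noteq> []" using assms eq unfolding circuit_def by auto
  then show "circuit fs' gs'"
    using circuit_perm[of fs fs'] circuit_perm[of gs' gs] eq assms circuit_trans by metis
qed (use assms in auto)

lemma mcircuit_refl: "M \<noteq> {#} \<Longrightarrow> mcircuit M M"
  unfolding mcircuit_def by (metis circuit_perm mset_zero_iff)

lemma mcircuit_sym: "mcircuit M N \<Longrightarrow> mcircuit N M"
  unfolding mcircuit_def by (metis circuit_def circuit_sym ex_mset length_0_conv mset_zero_iff)

lemma mcircuit_trans: "mcircuit L M \<Longrightarrow> mcircuit M N \<Longrightarrow> mcircuit L N"
  unfolding mcircuit_def by (metis circuit_trans ex_mset)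

lemma mcircuit_add:
  assumes "mcircuit M N"
  shows "mcircuit (M + L) (N + L)"
proof -
  obtain fs gs hs where "mset fs = M" "mset gs = N" "mset hs = L" by (metis ex_mset)
  with assms mcircuitI[OF circuit_append, of fs gs hs] show ?thesis
    unfolding mcircuit_def by auto
qed

text \<open>The constants cancelled during a derivation are collected in one \<open>C\<close>, which
  all other steps merely carry along.\<close>

lemma eqv_imp_mcircuit: "M \<approx> N \<Longrightarrow> \<exists>C. all_const C \<and> mcircuit (M + C) (N + C)"
proof (induction rule: eqv.induct)
  case (refl M)
  \<comment> \<open>\<open>M\<close> may be empty and no gate acts on zero bits, so a constant wire
    is supplied.\<close>
  show ?case by (rule exI[of _ "{#\<lambda>_. 0#}"]) (auto simp: mcircuit_refl)
next
  case (sym M N)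
  then show ?case using mcircuit_sym by blast
next
  case (trans L M N)
  then obtain C D where "all_const C" "mcircuit (L + C) (M + C)"
    and "all_const D" "mcircuit (M + D) (N + D)" by blast
  then have "all_const (C + D)" "mcircuit (L + (C + D)) (N + (C + D))"
    using mcircuit_add[of "L + C" "M + C" D] mcircuit_add[of "M + D" "N + D" C] mcircuit_trans
    by (auto simp: ac_simps)
  then show ?case by blast
next
  case (add M N L)
  then obtain C where "all_const C" "mcircuit (M + C) (N + C)" by blast
  then show ?case using mcircuit_add[of "M + C" "N + C" L] by (auto simp: ac_simps)
next
  case (cancel_const M b N)
  then obtain C where "all_const C" "mcircuit (M + {#\<lambda>_. b#} + C) (N + {#\<lambda>_. b#} + C)" by blast
  then show ?case by (intro exI[of _ "{#\<lambda>_. b#} + C"]) (auto simp: ac_simps)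
next
  case (gate fs)
  have "fs \<noteq> []" using gate rev by (auto simp: reversible_def)
  then show ?case using mcircuitI[OF circuit_gate[OF gate]] by (intro exI[of _ "{#}"]) simp
qed

text \<open>The leftover constants form the ancilla string. The points \<open>d\<close> realise
  every input \<open>x\<close> of \<open>F\<close>, so the relation between the wires fixes the gate
  completely.\<close>

lemma generated_of_eqv:
  assumes "reversible m F" "length fs = m"
    and "\<And>x. length x = m \<Longrightarrow> \<exists>d. map (\<lambda>f. f d) fs = x \<and> map (\<lambda>f. f d) gs = F x"
    and "mset fs \<approx> mset gs"
  shows "(m, F) \<in> gen"
proof -
  obtain C where C: "all_const C" "mcircuit (mset fs + C) (mset gs + C)"
    using eqv_imp_mcircuit[OF assms(4)] by blast
  obtain cs where cs: "mset cs = C" by (metis ex_mset)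
  \<comment> \<open>The wires in \<open>cs\<close> are constant, so evaluating at
    \<open>undefined\<close> gives their common value.\<close>
  define a where "a = map (\<lambda>f. f undefined) cs"
  have const: "map (\<lambda>f. f d) cs = a" for d
  proof -
    have "f d = f undefined" if "f \<in> set cs" for f
      using C(1) that unfolding all_const_def cs[symmetric] set_mset_mset by metis
    then show ?thesis by (simp add: a_def)
  qed
  have "circuit (fs @ cs) (gs @ cs)" using C(2) cs unfolding mcircuit_def by auto
  then obtain H where H: "(length (fs @ cs), H) \<in> gen"
    "\<And>d. H (map (\<lambda>f. f d) (fs @ cs)) = map (\<lambda>f. f d) (gs @ cs)"
    unfolding circuit_def by blast
  show ?thesis
  proof (rule generated.ancilla[of m "length cs" H _ a])
    show "(m + length cs, H) \<in> gen" using H(1) assms(2) by simp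
    show "a \<in> bit_strings (length cs)" by (simp add: a_def bit_strings_def)
    fix x assume "x \<in> bit_strings m"
    then obtain d where "map (\<lambda>f. f d) fs = x" "map (\<lambda>f. f d) gs = F x"
      using assms(3) by (auto simp: bit_strings_def)
    then show "H (x @ a) = F x @ a" using H(2)[of d] by (simp add: const)
  qed fact
qed

lemmas [trans] = eqv.trans

lemma eqv_rewrite: "M \<approx> M' \<Longrightarrow> A = M + R \<Longrightarrow> B = M' + R \<Longrightarrow> A \<approx> B"
  by (simp add: eqv.add)

lemma eqv_union: "M \<approx> M' \<Longrightarrow> N \<approx> N' \<Longrightarrow> M + N \<approx> M' + N'"
  using eqv.add[of M M' N] eqv.add[of N N' M'] eqv.trans by (metis add.commute)

lemma eqv_cancel_all_const: "all_const D \<Longrightarrow> M + D \<approx> N + D \<Longrightarrow> M \<approx> N"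
proof (induction D)
  case (add f D)
  then obtain b where "f = (\<lambda>_. b)" "all_const D" by auto
  with add show ?case using eqv.cancel_const[of "M + D" b "N + D"] by simp
qed simp

section \<open>The gate along edges, copying, and removal of catalysts\<close>

definition out :: "nat set \<Rightarrow> nat set" where
  "out S = set_of_bits (G (bits_of_set n S))"

lemma bij_betw_out: "bij_betw out (Pow {..<n}) (Pow {..<n})"
proof -
  have "bij_betw G (bit_strings n) (bit_strings n)"
    using rev by (simp add: reversible_def permutes_imp_bij)
  then have "bij_betw (set_of_bits \<circ> (G \<circ> bits_of_set n)) (Pow {..<n}) (Pow {..<n})"
    using bij_betw_bits_of_set bij_betw_set_of_bits by (intro bij_betw_trans)
  then show ?thesis by (simp add: out_def[abs_def] comp_def)
qed

lemma nth_G_bits_of_set: "i < n \<Longrightarrow> G (bits_of_set n S) ! i = of_bool (i \<in> out S)"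
  by (simp add: out_def set_of_bits_def G_length)

text \<open>Indexing the wires by position allows single wires to be split off later.\<close>

lemma eqv_image_gate:
  fixes v :: "nat \<Rightarrow> 'd \<Rightarrow> bit"
  shows "image_mset v (mset_set {..<n}) \<approx>
    image_mset (\<lambda>i d. of_bool (i \<in> out {l. l < n \<and> v l d = 1})) (mset_set {..<n})"
proof -
  have "map (\<lambda>f. f d) (map v [0..<n]) = bits_of_set n {l. l < n \<and> v l d = 1}" for d
    by (auto simp: bits_of_set_def)
  then have "gate_outputs (map v [0..<n]) = map (\<lambda>i d. of_bool (i \<in> out {l. l < n \<and> v l d = 1})) [0..<n]"
    by (simp add: gate_outputs_def nth_G_bits_of_set del: map_map)
  then show ?thesis
    using eqv.gate[of "map v [0..<n]"] by (simp add: lessThan_atLeast0)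
qed

definition neg :: "('d \<Rightarrow> bit) \<Rightarrow> 'd \<Rightarrow> bit" where
  "neg f d = of_bool (f d = 0)"

lemma neg_neg [simp]: "neg (neg f) = f"
  by (auto simp: neg_def fun_eq_iff)

text \<open>Along an edge, an output is \<open>f\<close>, \<open>neg f\<close> or constant according
  to whether its bit rises, falls or stays. The constants are chosen before \<open>f\<close>, as a
  copier requires.\<close>

lemma eqv_line:
  assumes S: "S \<subseteq> {..<n}" "j \<in> {..<n} - S"
  obtains C C' :: "('d \<Rightarrow> bit) multiset" where "all_const C" "all_const C'"
    "\<And>f. {#f#} + C \<approx> replicate_mset (card (out (insert j S) - out S)) f
      + replicate_mset (card (out S - out (insert j S))) (neg f) + C'"
proof
  define P Q where "P = out (insert j S) - out S" and "Q = out S - out (insert j S)"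
  define R where "R = {..<n} - P - Q"
  define C where "C = image_mset (\<lambda>l _ :: 'd. of_bool (l \<in> S) :: bit) (mset_set ({..<n} - {j}))"
  define C' where "C' = image_mset (\<lambda>l _ :: 'd. of_bool (l \<in> out S) :: bit) (mset_set R)"
  show "all_const C" "all_const C'" by (auto simp: all_const_def C_def C'_def)
  have sub: "out T \<subseteq> {..<n}" if "T \<subseteq> {..<n}" for T
    using bij_betw_out that unfolding bij_betw_def by blast
  have PQR: "{..<n} = P \<union> Q \<union> R" "finite P" "finite Q" "finite R" "P \<inter> Q = {}" "(P \<union> Q) \<inter> R = {}"
    using sub[of S] sub[of "insert j S"] S
    by (auto simp: P_def Q_def R_def intro: finite_subset[of _ "{..<n}"])
  fix f :: "'d \<Rightarrow> bit"
  define v where "v = (\<lambda>l. if l = j then f else (\<lambda>_. of_bool (l \<in> S)))"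
  have set: "{l. l < n \<and> v l d = 1} = (if f d = 1 then insert j S else S)" for d
    using S by (auto simp: v_def split: if_splits)
  have "image_mset v (mset_set {..<n}) = {#f#} + image_mset v (mset_set ({..<n} - {j}))"
    using S by (subst mset_set.remove[of _ j]) (auto simp: v_def)
  also have "image_mset v (mset_set ({..<n} - {j})) = C"
    unfolding C_def by (intro image_mset_cong) (auto simp: v_def)
  finally have lhs: "image_mset v (mset_set {..<n}) = {#f#} + C" .
  define w where "w = (\<lambda>i d. of_bool (i \<in> out {l. l < n \<and> v l d = 1}) :: bit)"
  have "image_mset w (mset_set {..<n})
      = image_mset w (mset_set P) + image_mset w (mset_set Q) + image_mset w (mset_set R)"
    using PQR by (simp add: mset_set_Union)
  also have "image_mset w (mset_set P) = image_mset (\<lambda>_. f) (mset_set P)"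
    by (intro image_mset_cong ext) (use PQR in \<open>auto simp: w_def set P_def\<close>)
  also have "\<dots> = replicate_mset (card P) f" by (simp add: image_mset_const_eq)
  also have "image_mset w (mset_set Q) = image_mset (\<lambda>_. neg f) (mset_set Q)"
    by (intro image_mset_cong ext) (use PQR in \<open>auto simp: w_def set Q_def neg_def\<close>)
  also have "\<dots> = replicate_mset (card Q) (neg f)" by (simp add: image_mset_const_eq)
  also have "image_mset w (mset_set R) = C'"
  proof -
    have "i \<in> out (insert j S) \<longleftrightarrow> i \<in> out S" if "i \<in> R" for i
      using that by (auto simp: R_def P_def Q_def)
    then show ?thesis
      unfolding C'_def using PQR by (intro image_mset_cong ext) (simp add: w_def set)
  qed
  finally show "{#f#} + C \<approx> replicate_mset (card (out (insert j S) - out S)) f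
      + replicate_mset (card (out S - out (insert j S))) (neg f) + C'"
    using eqv_image_gate[of v] unfolding lhs w_def P_def Q_def by simp
qed

text \<open>A copier stands in for fan-out: in the presence of \<open>f\<close>, a fixed supply \<open>K\<close> of constants can be
  turned into a multiset \<open>h f\<close> that contains \<open>f\<close> again. As the supply does not depend on \<open>f\<close>, the
  multiset can be erased from any other collection of wires that computes \<open>f\<close>.\<close>

definition copier :: "('d \<Rightarrow> bit) multiset \<Rightarrow> (('d \<Rightarrow> bit) \<Rightarrow> ('d \<Rightarrow> bit) multiset) \<Rightarrow> bool" where
  "copier K h \<longleftrightarrow> all_const K \<and> (\<forall>f. f \<in># h f \<and> {#f#} + K \<approx> {#f#} + h f)"

text \<open>The supply must become exactly \<open>h f\<close>, without garbage; read backwards, the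
  relation therefore erases \<open>h f\<close>.\<close>

definition computable ::
    "('d \<Rightarrow> bit) multiset \<Rightarrow> (('d \<Rightarrow> bit) \<Rightarrow> ('d \<Rightarrow> bit) multiset) \<Rightarrow> ('d \<Rightarrow> bit) multiset \<Rightarrow> ('d \<Rightarrow> bit) set" where
  "computable K h A = {f. A + K \<approx> A + h f}"

lemma computable_add: "f \<in> computable K h A \<Longrightarrow> f \<in> computable K h (A + B)"
  unfolding computable_def using eqv.add[of "A + K" "A + h f" B] by (simp add: ac_simps)

lemma computable_self:
  assumes "copier K h" "f \<in># A"
  shows "f \<in> computable K h A"
proof -
  obtain B where "A = {#f#} + B" using assms(2) by (auto dest: multi_member_split)
  with assms(1) show ?thesis
    using computable_add[of f K h "{#f#}" B] by (simp add: copier_def computable_def)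
qed

text \<open>A constant wire can be borrowed: add it, let it be copied, cancel it.\<close>

lemma computable_const:
  assumes "copier K h"
  shows "(\<lambda>_. b) \<in> computable K h A"
proof -
  have "K + {#\<lambda>_. b#} \<approx> h (\<lambda>_. b) + {#\<lambda>_. b#}"
    using assms unfolding copier_def by (metis add.commute)
  then have "K \<approx> h (\<lambda>_. b)" by (rule eqv.cancel_const)
  then show ?thesis unfolding computable_def using eqv_union[OF eqv.refl] by blast
qed

text \<open>Each wire is created from a fresh supply \<open>K\<close> while \<open>A\<close> stays
  intact; the rest of each \<open>h (v l)\<close> becomes the garbage \<open>R\<close>.\<close>

lemma computable_extract:
  assumes "copier K h" "finite L" "\<And>l. l \<in> L \<Longrightarrow> v l \<in> computable K h A"
  shows "\<exists>D R. all_const D \<and> A + D \<approx> A + R + image_mset v (mset_set L)"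
  using assms(2,3)
proof (induction L rule: finite_induct)
  case empty
  show ?case by (intro exI[of _ "{#}"]) (simp add: eqv.refl)
next
  case (insert l L)
  then obtain D R where D: "all_const D" "A + D \<approx> A + R + image_mset v (mset_set L)" by auto
  obtain r where r: "h (v l) = {#v l#} + r"
    using assms(1) by (auto simp: copier_def dest: multi_member_split)
  have "A + (D + K) \<approx> A + R + image_mset v (mset_set L) + K"
    using eqv.add[OF D(2), of K] by (simp add: ac_simps)
  also have "\<dots> \<approx> A + (R + r) + image_mset v (mset_set (insert l L))"
  proof (rule eqv_rewrite)
    show "A + K \<approx> A + h (v l)" using insert by (auto simp: computable_def)
  qed (use insert in \<open>simp_all add: r ac_simps\<close>)
  finally show ?case using D(1) assms(1) by (intro exI[of _ "D + K"] exI[of _ "R + r"]) (simp add: copier_def)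
qed

text \<open>The garbage of a direct computation would spoil the exact form of
  \<open>computable\<close>. The output is therefore copied and the computation then
  reversed.\<close>

lemma computable_gate:
  fixes v :: "nat \<Rightarrow> 'd \<Rightarrow> bit"
  assumes "copier K h" "i < n" "\<And>l. l < n \<Longrightarrow> v l \<in> computable K h A"
  shows "(\<lambda>d. of_bool (i \<in> out {l. l < n \<and> v l d = 1})) \<in> computable K h A"
proof -
  define w where "w = (\<lambda>i d. of_bool (i \<in> out {l. l < n \<and> v l d = 1}) :: bit)"
  obtain D R where D: "all_const D" "A + D \<approx> A + R + image_mset v (mset_set {..<n})"
    using computable_extract[OF assms(1), of "{..<n}" v A] assms(3) by auto
  have "A + R + image_mset v (mset_set {..<n}) \<approx> A + R + image_mset w (mset_set {..<n})"
    unfolding w_def by (intro eqv_union eqv.refl eqv_image_gate)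
  with D(2) have "A + D \<approx> A + R + image_mset w (mset_set {..<n})" by (rule eqv.trans)
  also have "image_mset w (mset_set {..<n}) = {#w i#} + image_mset w (mset_set ({..<n} - {i}))"
    using assms(2) by (subst mset_set.remove[of _ i]) auto
  finally obtain R' where R': "A + D \<approx> {#w i#} + R'" by (metis add.left_commute)
  have "(A + K) + D \<approx> {#w i#} + R' + K"
    using eqv.add[OF R', of K] by (simp add: ac_simps)
  also have "\<dots> \<approx> {#w i#} + R' + h (w i)"
  proof (rule eqv_rewrite)
    show "{#w i#} + K \<approx> {#w i#} + h (w i)" using assms(1) by (simp add: copier_def)
  qed (simp_all add: ac_simps)
  \<comment> \<open>Uncompute: only the copy \<open>h (w i)\<close> and the constants
    \<open>D\<close> remain beside \<open>A\<close>.\<close>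
  also have "\<dots> \<approx> (A + h (w i)) + D"
    by (rule eqv_rewrite[OF eqv.sym[OF R'], of _ "h (w i)"]) (simp_all add: ac_simps)
  finally show ?thesis
    using eqv_cancel_all_const[OF D(1)] unfolding computable_def w_def by blast
qed

text \<open>\<open>M\<close> creates a copy of \<open>f\<close> from \<open>K\<close>, this copy
  acts as the catalyst, and \<open>N\<close> erases it.\<close>

lemma eqv_cancel_computable:
  assumes "copier K h" "f \<in> computable K h M" "f \<in> computable K h N" "M + {#f#} \<approx> N + {#f#}"
  shows "M \<approx> N"
proof -
  obtain r where r: "h f = {#f#} + r"
    using assms(1) by (auto simp: copier_def dest: multi_member_split)
  have "M + K \<approx> M + h f" using assms(2) by (simp add: computable_def)
  also have "\<dots> \<approx> N + h f"
    by (rule eqv_rewrite[OF assms(4), of _ r]) (simp_all add: r ac_simps)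
  also have "\<dots> \<approx> N + K" using assms(3) by (auto simp: computable_def intro: eqv.sym)
  finally show ?thesis using assms(1) eqv_cancel_all_const unfolding copier_def by blast
qed

lemma eqv_cancel_complete:
  assumes "copier K h" "computable K h M = UNIV" "computable K h N = UNIV"
  shows "M + F \<approx> N + F \<Longrightarrow> M \<approx> N"
proof (induction F)
  case (add f F)
  have "M + F \<approx> N + F"
  proof (rule eqv_cancel_computable[OF assms(1)])
    show "f \<in> computable K h (M + F)" "f \<in> computable K h (N + F)"
      using assms(2,3) by (auto intro: computable_add)
    show "M + F + {#f#} \<approx> N + F + {#f#}" using add.prems by simp
  qed
  then show ?case by (rule add.IH)
qed simp

text \<open>This is equality in the Grothendieck group of the monoid of multisets modulo
  \<open>\<approx>\<close>; \<open>F\<close> is a catalyst.\<close>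

definition stable_eqv :: "('d \<Rightarrow> bit) multiset \<Rightarrow> ('d \<Rightarrow> bit) multiset \<Rightarrow> bool" (infix "\<approx>\<^sub>s" 50) where
  "M \<approx>\<^sub>s N \<longleftrightarrow> (\<exists>F. M + F \<approx> N + F)"

lemma stable_eqvI: "M \<approx> N \<Longrightarrow> M \<approx>\<^sub>s N"
  unfolding stable_eqv_def by (rule exI[of _ "{#}"]) simp

lemma stable_eqv_sym: "M \<approx>\<^sub>s N \<Longrightarrow> N \<approx>\<^sub>s M"
  unfolding stable_eqv_def using eqv.sym by blast

lemma stable_eqv_union:
  assumes "M \<approx>\<^sub>s M'" "N \<approx>\<^sub>s N'"
  shows "M + N \<approx>\<^sub>s M' + N'"
proof -
  obtain E F where "M + E \<approx> M' + E" "N + F \<approx> N' + F"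
    using assms unfolding stable_eqv_def by blast
  then have "(M + E) + (N + F) \<approx> (M' + E) + (N' + F)" by (rule eqv_union)
  then show ?thesis unfolding stable_eqv_def by (intro exI[of _ "E + F"]) (simp add: ac_simps)
qed

lemma stable_eqv_cancel: "M + L \<approx>\<^sub>s N + L \<Longrightarrow> M \<approx>\<^sub>s N"
  unfolding stable_eqv_def by (metis add.assoc)

lemma stable_eqv_trans [trans]:
  assumes "L \<approx>\<^sub>s M" "M \<approx>\<^sub>s N"
  shows "L \<approx>\<^sub>s N"
proof (rule stable_eqv_cancel)
  show "L + M \<approx>\<^sub>s N + M"
    using stable_eqv_union[OF assms] by (simp only: add.commute[of M N])
qed

text \<open>Assigning the values \<open>a\<close> and \<open>a'\<close> at \<open>d\<close> shifts the class of a wire by an amount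
  independent of the wire.\<close>

lemma exchangeI:
  assumes shift: "\<And>f. {#f(d := a)#} + T \<approx>\<^sub>s {#f(d := a')#} + T'" and "a \<noteq> a'"
  shows "{#f(d := 1), f'(d := 0)#} \<approx>\<^sub>s {#f(d := 0), f'(d := 1 :: bit)#}"
proof -
  \<comment> \<open>The shift for \<open>f\<close> and the reversed shift for \<open>f'\<close>
    leave \<open>T + T'\<close> on both sides.\<close>
  have "({#f(d := a)#} + T) + ({#f'(d := a')#} + T') \<approx>\<^sub>s ({#f(d := a')#} + T') + ({#f'(d := a)#} + T)"
    by (intro stable_eqv_union shift stable_eqv_sym[OF shift])
  then have ex: "{#f(d := a), f'(d := a')#} \<approx>\<^sub>s {#f(d := a'), f'(d := a)#}"
    by - (rule stable_eqv_cancel[where L = "T + T'"], simp add: ac_simps add_mset_commute)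
  show ?thesis
  proof (cases "a = 0")
    case True
    then show ?thesis using ex \<open>a \<noteq> a'\<close> by (auto intro: stable_eqv_sym)
  next
    case False
    then show ?thesis using ex \<open>a \<noteq> a'\<close> by auto
  qed
qed

end

section \<open>Non-affine gates\<close>

text \<open>Equivalently, \<open>g\<close> has degree 2: it is of the form \<open>(x + a) * (y + b) + c\<close>.\<close>

definition odd_weight :: "(bit \<Rightarrow> bit \<Rightarrow> bit) \<Rightarrow> bool" where
  "odd_weight g \<longleftrightarrow> (g 0 0 = g 1 0) \<noteq> (g 0 1 = g 1 1)"

lemma all_bit: "(\<forall>b :: bit. P b) \<longleftrightarrow> P 0 \<and> P 1"
  by (metis bit_not_one_iff)

lemma ex_bit: "(\<exists>b :: bit. P b) \<longleftrightarrow> P 0 \<or> P 1"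
  by (metis bit_not_one_iff)

text \<open>Up to negations \<open>g\<close> is a conjunction, so one value of each argument makes
  the other irrelevant.\<close>

lemma odd_weight_const_left: "odd_weight g \<Longrightarrow> \<exists>a c. \<forall>b. g a b = c"
  unfolding odd_weight_def all_bit ex_bit
  by (cases "g 0 0"; cases "g 0 1"; cases "g 1 0"; cases "g 1 1") auto

lemma odd_weight_const_right: "odd_weight g \<Longrightarrow> \<exists>b c. \<forall>a. g a b = c"
  unfolding odd_weight_def all_bit ex_bit
  by (cases "g 0 0"; cases "g 0 1"; cases "g 1 0"; cases "g 1 1") auto

text \<open>At the other value of the right argument \<open>g\<close> returns the left one up to
  negation, which \<open>c\<close> undoes.\<close>

lemma odd_weight_bij: "odd_weight g \<Longrightarrow> \<exists>b c. \<forall>a. g (a + c) b = a"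
  unfolding odd_weight_def all_bit ex_bit
  by (cases "g 0 0"; cases "g 0 1"; cases "g 1 0"; cases "g 1 1") auto

lemma odd_weight_and: "odd_weight g \<Longrightarrow> \<exists>a b c. \<forall>x y. x * y = g (x + a) (y + b) + c"
  unfolding odd_weight_def all_bit ex_bit
  by (cases "g 0 0"; cases "g 0 1"; cases "g 1 0"; cases "g 1 1") auto

locale nonaffine_gate = reversible_gate +
  assumes nonaffine: "\<not> affine_gate n G"
begin

text \<open>Otherwise all mixed second differences vanish and \<open>affine_gateI\<close>
  applies.\<close>

lemma odd_square:
  obtains S j k i where "S \<subseteq> {..<n}" "j \<in> {..<n} - S" "k \<in> {..<n} - S" "j \<noteq> k" "i < n"
    "((i \<in> out S) = (i \<in> out (insert j S))) \<noteq>
      ((i \<in> out (insert k S)) = (i \<in> out (insert k (insert j S))))"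
proof -
  have parity: "(of_bool a + of_bool b = (of_bool c + of_bool d :: bit)) \<longleftrightarrow> (a = b) = (c = d)" for a b c d
    by (cases a; cases b; cases c; cases d) simp_all
  show thesis
    using affine_gateI[OF rev] nonaffine that nth_G_bits_of_set parity by metis
qed

lemma two_flips:
  obtains S j a b where "S \<subseteq> {..<n}" "j \<in> {..<n} - S" "a \<noteq> b"
    "(a \<in> out S) \<noteq> (a \<in> out (insert j S))" "(b \<in> out S) \<noteq> (b \<in> out (insert j S))"
proof -
  obtain S j k i where "S \<subseteq> {..<n}" "j \<in> {..<n} - S" "k \<in> {..<n} - S" "j \<noteq> k"
    "((i \<in> out S) = (i \<in> out (insert j S))) \<noteq>
      ((i \<in> out (insert k S)) = (i \<in> out (insert k (insert j S))))"
    using odd_square by metis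
  from two_flips_of_odd_square[OF bij_betw_imp_inj_on[OF bij_betw_out] this] that show thesis by metis
qed

text \<open>A double flip excludes monotonicity. The falling bit is what makes negation
  computable.\<close>

lemma falling_edge:
  obtains S j i where "S \<subseteq> {..<n}" "j \<in> {..<n} - S" "i < n" "i \<in> out S" "i \<notin> out (insert j S)"
proof -
  obtain S j a b where "S \<subseteq> {..<n}" "j \<in> {..<n} - S" "a \<noteq> b"
    "(a \<in> out S) \<noteq> (a \<in> out (insert j S))" "(b \<in> out S) \<noteq> (b \<in> out (insert j S))"
    using two_flips by metis
  from subset_bijection_not_monotone[OF _ bij_betw_out this]
  obtain T k i where T: "T \<subseteq> {..<n}" "k \<in> {..<n} - T" "i \<in> out T" "i \<notin> out (insert k T)"
    by auto
  have "out T \<subseteq> {..<n}" using bij_betw_out T(1) unfolding bij_betw_def by blast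
  with T that show thesis by blast
qed

text \<open>An edge that flips two bits turns one wire into at least two, each \<open>f\<close> or
  \<open>neg f\<close>. If no bit falls, one run suffices; otherwise a second run on one of the
  wires \<open>neg f\<close> is sure to return \<open>f\<close>.\<close>

lemma copier_exists:
  obtains K and h :: "('d \<Rightarrow> bit) \<Rightarrow> ('d \<Rightarrow> bit) multiset" where "copier K h"
proof -
  obtain S j a b where S: "S \<subseteq> {..<n}" "j \<in> {..<n} - S" and "a \<noteq> b"
    "(a \<in> out S) \<noteq> (a \<in> out (insert j S))" "(b \<in> out S) \<noteq> (b \<in> out (insert j S))"
    using two_flips by metis
  define P Q where "P = out (insert j S) - out S" and "Q = out S - out (insert j S)"
  have "out S \<subseteq> {..<n}" "out (insert j S) \<subseteq> {..<n}"
    using bij_betw_out S unfolding bij_betw_def by blast+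
  then have fin: "finite P" "finite Q" by (auto simp: P_def Q_def intro: finite_subset[of _ "{..<n}"])
  have "card {a, b} \<le> card (P \<union> Q)"
    using fin \<open>(a \<in> out S) \<noteq> _\<close> \<open>(b \<in> out S) \<noteq> _\<close> by (intro card_mono) (auto simp: P_def Q_def)
  then have two: "2 \<le> card P + card Q"
    using \<open>a \<noteq> b\<close> card_Un_le[of P Q] by simp
  obtain C C' :: "('d \<Rightarrow> bit) multiset" where C: "all_const C" "all_const C'"
    and line: "\<And>f. {#f#} + C \<approx> replicate_mset (card P) f + replicate_mset (card Q) (neg f) + C'"
    by (rule eqv_line[OF S, folded P_def Q_def]) (rule that)
  show thesis
  proof (cases "card Q")
    case 0
    \<comment> \<open>Of the \<open>card P\<close> wires \<open>f\<close> one is kept, and the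
      remaining \<open>Suc p\<close> go into the copy.\<close>
    define p where "p = card P - 2"
    have p: "card P = Suc (Suc p)" using two 0 by (simp add: p_def)
    show thesis
    proof (rule that[of C "\<lambda>f. replicate_mset (Suc p) f + C'"])
      show "copier C (\<lambda>f. replicate_mset (Suc p) f + C')"
        using C(1) line by (simp add: copier_def 0 p)
    qed
  next
    case (Suc q)
    \<comment> \<open>After the second run \<open>f\<close> and \<open>neg f\<close> each occur
      \<open>card P + q\<close> times besides the kept \<open>f\<close>; this number is positive
      because two bits flip.\<close>
    define r where "r = card P + q - 1"
    have r: "card P + q = Suc r" using two Suc by (simp add: r_def)
    let ?h = "\<lambda>f. replicate_mset (Suc r) f + replicate_mset (Suc r) (neg f) + (C' + C')"
    have "{#f#} + (C + C) \<approx> {#f#} + ?h f" for f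
    proof -
      have "{#f#} + (C + C) \<approx> replicate_mset (card P) f + replicate_mset (card Q) (neg f) + C' + C"
        using eqv.add[OF line[of f], of C] by (simp add: ac_simps)
      also have "\<dots> \<approx> {#f#} + ?h f"
      proof (rule eqv_rewrite[OF line[of "neg f"],
            of _ "replicate_mset (card P) f + replicate_mset q (neg f) + C'"])
        show "replicate_mset (card P) f + replicate_mset (card Q) (neg f) + C' + C =
          {#neg f#} + C + (replicate_mset (card P) f + replicate_mset q (neg f) + C')"
          by (simp add: Suc ac_simps)
        have "replicate_mset (Suc r) g = replicate_mset (card P) g + replicate_mset q g" for g :: "'d \<Rightarrow> bit"
          by (simp flip: r add: multiset_eq_iff)
        then show "{#f#} + ?h f =
          replicate_mset (card P) (neg f) + replicate_mset (card Q) (neg (neg f)) + C' +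
            (replicate_mset (card P) f + replicate_mset q (neg f) + C')"
          by (simp add: Suc ac_simps del: replicate_mset_Suc) (simp add: ac_simps)
      qed
      finally show ?thesis .
    qed
    then show thesis using C(1) by (intro that[of "C + C" ?h]) (simp add: copier_def)
  qed
qed

lemma computable_neg:
  assumes "copier K h" "f \<in> computable K h A"
  shows "neg f \<in> computable K h A"
proof -
  obtain S j i where S: "S \<subseteq> {..<n}" "j \<in> {..<n} - S" "i < n" "i \<in> out S" "i \<notin> out (insert j S)"
    by (rule falling_edge)
  define v where "v = (\<lambda>l. if l = j then f else (\<lambda>_. of_bool (l \<in> S)))"
  have "{l. l < n \<and> v l d = 1} = (if f d = 1 then insert j S else S)" for d
    using S by (auto simp: v_def split: if_splits)
  then have "neg f = (\<lambda>d. of_bool (i \<in> out {l. l < n \<and> v l d = 1}))"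
    using S by (auto simp: neg_def fun_eq_iff)
  moreover have "v l \<in> computable K h A" for l
    using assms computable_const[OF assms(1)] by (simp add: v_def)
  ultimately show ?thesis using computable_gate[OF assms(1) S(3)] by auto
qed

section \<open>Two-dimensional faces and the computation of all Boolean functions\<close>

definition face :: "nat set \<Rightarrow> nat \<Rightarrow> nat \<Rightarrow> ('d \<Rightarrow> bit) \<Rightarrow> ('d \<Rightarrow> bit) \<Rightarrow> nat \<Rightarrow> 'd \<Rightarrow> bit" where
  "face S j k s t l = (if l = j then s else if l = k then t else (\<lambda>_. of_bool (l \<in> S)))"

lemma odd_face:
  obtains S j k i g where "j < n" "k < n" "j \<noteq> k" "i < n" "odd_weight g"
    "\<And>(s :: 'd \<Rightarrow> bit) t. (\<lambda>d. of_bool (i \<in> out {l. l < n \<and> face S j k s t l d = 1})) = (\<lambda>d. g (s d) (t d))"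
proof -
  obtain S j k i where S: "S \<subseteq> {..<n}" "j \<in> {..<n} - S" "k \<in> {..<n} - S" "j \<noteq> k" "i < n"
    and odd: "((i \<in> out S) = (i \<in> out (insert j S))) \<noteq>
      ((i \<in> out (insert k S)) = (i \<in> out (insert k (insert j S))))"
    by (rule odd_square)
  \<comment> \<open>\<open>U a b\<close> is the corner of the face whose free inputs are
    \<open>a\<close> and \<open>b\<close>.\<close>
  define U where "U a b = S \<union> {l. l = j \<and> a = 1} \<union> {l. l = k \<and> b = 1}" for a b :: bit
  define g where "g a b = (of_bool (i \<in> out (U a b)) :: bit)" for a b
  have "U 0 0 = S" "U 1 0 = insert j S" "U 0 1 = insert k S" "U 1 1 = insert k (insert j S)"
    by (auto simp: U_def)
  then have "odd_weight g" using odd by (simp only: odd_weight_def g_def of_bool_eq_iff not_False_eq_True)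
  moreover have "{l. l < n \<and> face S j k s t l d = 1} = U (s d) (t d)" for s t :: "'d \<Rightarrow> bit" and d
    using S by (auto simp: U_def face_def split: if_splits)
  ultimately show thesis
    using S by (intro that[of j k i g S]) (auto simp: g_def)
qed

lemma computable_add_const:
  assumes "copier K h" "f \<in> computable K h A"
  shows "(\<lambda>d. f d + b) \<in> computable K h A"
proof -
  have "(\<lambda>d. f d + b) = (if b = 0 then f else neg f)"
    by (cases b) (auto simp: neg_def fun_eq_iff)
  then show ?thesis using assms computable_neg by auto
qed

lemma computable_and:
  assumes "copier K h" "s \<in> computable K h A" "t \<in> computable K h A"
  shows "(\<lambda>d. s d * t d) \<in> computable K h A"
proof -
  obtain S j k i g where i: "i < n" and "odd_weight g"
    and g: "\<And>(s :: 'a \<Rightarrow> bit) t. (\<lambda>d. of_bool (i \<in> out {l. l < n \<and> face S j k s t l d = 1})) = (\<lambda>d. g (s d) (t d))"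
    by (rule odd_face) (rule that)
  then obtain a b c where abc: "x * y = g (x + a) (y + b) + c" for x y
    using odd_weight_and by metis
  have "face S j k (\<lambda>d. s d + a) (\<lambda>d. t d + b) l \<in> computable K h A" for l
    using assms computable_const computable_add_const by (auto simp: face_def simp del: add_bit_eq_xor)
  then have "(\<lambda>d. g (s d + a) (t d + b)) \<in> computable K h A"
    using computable_gate[OF assms(1) i, of "face S j k (\<lambda>d. s d + a) (\<lambda>d. t d + b)"] by (simp only: g)
  then have "(\<lambda>d. g (s d + a) (t d + b) + c) \<in> computable K h A"
    by (rule computable_add_const[OF assms(1)])
  then show ?thesis by (simp only: abc)
qed

lemma computable_if:
  assumes K: "copier K h" and "f \<in> computable K h A" "s \<in> computable K h A" "t \<in> computable K h A"
  shows "(\<lambda>d. if f d = 1 then s d else t d) \<in> computable K h A"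
proof -
  have "(\<lambda>d. if f d = 1 then s d else t d)
      = neg (\<lambda>d. neg (\<lambda>d. f d * s d) d * neg (\<lambda>d. neg f d * t d) d)"
    by (rule ext) (auto simp: neg_def)
  then show ?thesis using assms by (simp only: computable_neg computable_and)
qed

text \<open>A decision tree over the three coordinates, with constants at its leaves, spells out the
  truth table of any function.\<close>

lemma computable_eq_UNIV:
  assumes K: "copier K h"
    and "fst \<in> computable K h A" "fst \<circ> snd \<in> computable K h A" "snd \<circ> snd \<in> computable K h A"
  shows "computable K h A = (UNIV :: (bit \<times> bit \<times> bit \<Rightarrow> bit) set)"
proof -
  have "f \<in> computable K h A" for f
  proof -
    let ?if = "\<lambda>f s t d. if f d = 1 then s d else (t d :: bit)"
    let ?c = "\<lambda>x y z _. f (x, y, z)"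
    have "f = ?if fst
        (?if (fst \<circ> snd) (?if (snd \<circ> snd) (?c 1 1 1) (?c 1 1 0)) (?if (snd \<circ> snd) (?c 1 0 1) (?c 1 0 0)))
        (?if (fst \<circ> snd) (?if (snd \<circ> snd) (?c 0 1 1) (?c 0 1 0)) (?if (snd \<circ> snd) (?c 0 0 1) (?c 0 0 0)))"
      by (rule ext) auto
    also have "\<dots> \<in> computable K h A"
      using assms(2-4) by (intro computable_if[OF K] computable_const[OF K])
    finally show ?thesis .
  qed
  then show ?thesis by blast
qed

text \<open>Running \<open>G\<close> on a face at all points except \<open>d\<close>, and at \<open>d\<close> on preimages of two strings differing
  only in bit \<open>i\<close>, and cancelling the common outputs.\<close>

lemma stable_eqv_face:
  fixes d :: 'd
  obtains g a a' b b' and T T' :: "('d \<Rightarrow> bit) multiset" where "odd_weight g"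
    "\<And>s t. {#s(d := a), t(d := b), (\<lambda>x. g (s x) (t x))(d := 0)#} + T \<approx>\<^sub>s
      {#s(d := a'), t(d := b'), (\<lambda>x. g (s x) (t x))(d := 1)#} + T'"
proof -
  obtain S j k i g where jk: "j < n" "k < n" "j \<noteq> k" and i: "i < n" and "odd_weight g"
    and g: "\<And>(s :: 'd \<Rightarrow> bit) t. (\<lambda>x. of_bool (i \<in> out {l. l < n \<and> face S j k s t l x = 1})) = (\<lambda>x. g (s x) (t x))"
    by (rule odd_face) (rule that)
  \<comment> \<open>With these preimages as inputs at \<open>d\<close>, every output other than
    \<open>i\<close> is 0 at \<open>d\<close> in both runs.\<close>
  have "{i} \<in> out ` Pow {..<n}" "{} \<in> out ` Pow {..<n}"
    using bij_betw_out i unfolding bij_betw_def by auto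
  then obtain U U' where U: "U \<subseteq> {..<n}" "out U = {i}" and U': "U' \<subseteq> {..<n}" "out U' = {}"
    by auto
  \<comment> \<open>\<open>v W s t\<close> follows the face everywhere except at \<open>d\<close>,
    where the input is forced to be \<open>W\<close>.\<close>
  define v where "v W s t = (\<lambda>l. (face S j k s t l)(d := of_bool (l \<in> W)))" for W s t
  define w where "w s t m x = (of_bool (m \<in> out {l. l < n \<and> face S j k s t l x = 1}) :: bit)" for s t m and x :: 'd
  define T where "T W = image_mset (\<lambda>l. (\<lambda>_. of_bool (l \<in> S) :: bit)(d := of_bool (l \<in> W))) (mset_set ({..<n} - {j} - {k}))"
    for W :: "nat set"
  have v: "image_mset (v W s t) (mset_set {..<n})
      = {#s(d := of_bool (j \<in> W)), t(d := of_bool (k \<in> W))#} + T W" for W s t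
  proof -
    have "mset_set {..<n} = {#j, k#} + mset_set ({..<n} - {j} - {k})"
      using jk by (simp add: mset_set.remove[of "{..<n}" j] mset_set.remove[of "{..<n} - {j}" k])
    moreover have "image_mset (v W s t) (mset_set ({..<n} - {j} - {k})) = T W"
      unfolding T_def by (intro image_mset_cong) (auto simp: v_def face_def)
    ultimately show ?thesis using jk by (simp add: v_def face_def)
  qed
  have step: "image_mset (v W s t) (mset_set {..<n}) \<approx>
      {#(w s t i)(d := of_bool (i \<in> out W))#} + image_mset (\<lambda>m. (w s t m)(d := 0)) (mset_set ({..<n} - {i}))"
    if "W \<subseteq> {..<n}" "out W \<subseteq> {i}" for W s t
  proof -
    have "(\<lambda>m x. of_bool (m \<in> out {l. l < n \<and> v W s t l x = 1})) = (\<lambda>m. (w s t m)(d := of_bool (m \<in> out W)))"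
    proof (intro ext)
      fix m x
      have "{l. l < n \<and> v W s t l d = 1} = W" using that(1) by (auto simp: v_def)
      then show "of_bool (m \<in> out {l. l < n \<and> v W s t l x = 1}) = ((w s t m)(d := of_bool (m \<in> out W))) x"
        by (cases "x = d") (auto simp: w_def v_def)
    qed
    then have "image_mset (v W s t) (mset_set {..<n}) \<approx>
        image_mset (\<lambda>m. (w s t m)(d := of_bool (m \<in> out W))) (mset_set {..<n})"
      using eqv_image_gate[of "v W s t"] by simp
    also have "\<dots> = {#(w s t i)(d := of_bool (i \<in> out W))#}
        + image_mset (\<lambda>m. (w s t m)(d := of_bool (m \<in> out W))) (mset_set ({..<n} - {i}))"
      using i by (subst mset_set.remove[of _ i]) auto
    also have "image_mset (\<lambda>m. (w s t m)(d := of_bool (m \<in> out W))) (mset_set ({..<n} - {i}))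
        = image_mset (\<lambda>m. (w s t m)(d := 0)) (mset_set ({..<n} - {i}))"
      using that(2) by (intro image_mset_cong) auto
    finally show ?thesis .
  qed
  show thesis
  proof (rule that[OF \<open>odd_weight g\<close>, of "of_bool (j \<in> U)" "of_bool (k \<in> U)" "T U"
        "of_bool (j \<in> U')" "of_bool (k \<in> U')" "T U'"])
    fix s t :: "'d \<Rightarrow> bit"
    define r where "r = image_mset (\<lambda>m. (w s t m)(d := 0)) (mset_set ({..<n} - {i}))"
    define p where "p = (\<lambda>x. g (s x) (t x))"
    have w: "w s t i = p" unfolding p_def w_def using g by simp
    have 1: "{#s(d := of_bool (j \<in> U)), t(d := of_bool (k \<in> U))#} + T U \<approx> {#p(d := 1)#} + r"
      using step[OF U(1), of s t] unfolding v w r_def by (simp add: U(2))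
    have 0: "{#s(d := of_bool (j \<in> U')), t(d := of_bool (k \<in> U'))#} + T U' \<approx> {#p(d := 0)#} + r"
      using step[OF U'(1), of s t] unfolding v w r_def by (simp add: U'(2))
    \<comment> \<open>Each run carries the output of the other along, so that both arrive at the
      same multiset.\<close>
    have "{#s(d := of_bool (j \<in> U)), t(d := of_bool (k \<in> U)), p(d := 0)#} + T U \<approx> {#p(d := 1), p(d := 0)#} + r"
      by (rule eqv_rewrite[OF 1, of _ "{#p(d := 0)#}"]) (simp_all add: ac_simps add_mset_commute)
    also have "\<dots> \<approx> {#s(d := of_bool (j \<in> U')), t(d := of_bool (k \<in> U')), p(d := 1)#} + T U'"
      by (rule eqv_rewrite[OF eqv.sym[OF 0], of _ "{#p(d := 1)#}"]) (simp_all add: ac_simps add_mset_commute)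
    finally show "{#s(d := of_bool (j \<in> U)), t(d := of_bool (k \<in> U)), p(d := 0)#} + T U \<approx>\<^sub>s
        {#s(d := of_bool (j \<in> U')), t(d := of_bool (k \<in> U')), p(d := 1)#} + T U'"
      by (rule stable_eqvI)
  qed
qed

text \<open>The relation of \<open>stable_eqv_face\<close> is specialised until a single arbitrary
  wire changes its value at \<open>d\<close> and all else is fixed; then \<open>exchangeI\<close>
  applies.\<close>

lemma exchange: "{#f(d := 1), f'(d := 0)#} \<approx>\<^sub>s {#f(d := 0), f'(d := 1 :: bit)#}"
proof -
  obtain g a a' b b' T T' where g: "odd_weight g" and face:
    "\<And>s t. {#s(d := a), t(d := b), (\<lambda>x. g (s x) (t x))(d := 0)#} + T \<approx>\<^sub>s
      {#s(d := a'), t(d := b'), (\<lambda>x. g (s x) (t x))(d := 1)#} + T'"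
    by (rule stable_eqv_face) (rule that)
  consider "a \<noteq> a'" | "b \<noteq> b'" | "a = a'" "b = b'" by blast
  then show ?thesis
  proof cases
    case 1
    \<comment> \<open>This \<open>y\<close> freezes the output, so \<open>s\<close> is the only free
      wire left.\<close>
    obtain y c where "\<And>x. g x y = c" using odd_weight_const_right[OF g] by blast
    then have "{#s(d := a)#} + ({#(\<lambda>_. y)(d := b), (\<lambda>_. c)(d := 0)#} + T) \<approx>\<^sub>s
        {#s(d := a')#} + ({#(\<lambda>_. y)(d := b'), (\<lambda>_. c)(d := 1)#} + T')" for s
      using face[of s "\<lambda>_. y"] by (simp add: add_mset_commute)
    then show ?thesis by (rule exchangeI) (rule 1)
  next
    case 2
    obtain x c where "\<And>y. g x y = c" using odd_weight_const_left[OF g] by blast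
    then have "{#t(d := b)#} + ({#(\<lambda>_. x)(d := a), (\<lambda>_. c)(d := 0)#} + T) \<approx>\<^sub>s
        {#t(d := b')#} + ({#(\<lambda>_. x)(d := a'), (\<lambda>_. c)(d := 1)#} + T')" for t
      using face[of "\<lambda>_. x" t] by (simp add: add_mset_commute)
    then show ?thesis by (rule exchangeI) (rule 2)
  next
    case 3
    \<comment> \<open>Neither input changes at \<open>d\<close>, so both cancel; the output is made
      to be the free wire \<open>f\<close> itself.\<close>
    obtain y c where y: "\<And>x. g (x + c) y = x" using odd_weight_bij[OF g] by blast
    have "{#f(d := 0)#} + T \<approx>\<^sub>s {#f(d := 1)#} + T'" for f
    proof (rule stable_eqv_cancel)
      show "{#f(d := 0)#} + T + {#(\<lambda>x. f x + c)(d := a), (\<lambda>_. y)(d := b)#} \<approx>\<^sub>s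
          {#f(d := 1)#} + T' + {#(\<lambda>x. f x + c)(d := a), (\<lambda>_. y)(d := b)#}"
        using face[of "\<lambda>x. f x + c" "\<lambda>_. y"] 3 unfolding y by (simp add: add_mset_commute)
    qed
    then show ?thesis by (rule exchangeI) simp
  qed
qed

section \<open>The Fredkin gate as two exchanges\<close>

lemma fredkin_generated: "(3, fredkin) \<in> gen"
proof -
  let ?X = "fst :: bit \<times> bit \<times> bit \<Rightarrow> bit"
  let ?Y = "fst \<circ> snd :: bit \<times> bit \<times> bit \<Rightarrow> bit"
  let ?Z = "snd \<circ> snd :: bit \<times> bit \<times> bit \<Rightarrow> bit"
  let ?Y' = "\<lambda>d. if ?X d = 1 then ?Z d else ?Y d"
  let ?Z' = "\<lambda>d. if ?X d = 1 then ?Y d else ?Z d"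
  let ?M = "{#?X, ?Y, ?Z#}" and ?N = "{#?X, ?Y', ?Z'#}"
  obtain K and h :: "(bit \<times> bit \<times> bit \<Rightarrow> bit) \<Rightarrow> (bit \<times> bit \<times> bit \<Rightarrow> bit) multiset"
    where K: "copier K h" by (rule copier_exists)
  have M: "computable K h ?M = UNIV"
    by (rule computable_eq_UNIV[OF K]) (auto intro: computable_self[OF K])
  have N: "computable K h ?N = UNIV"
  proof (rule computable_eq_UNIV[OF K])
    have gens: "?X \<in> computable K h ?N" "?Y' \<in> computable K h ?N" "?Z' \<in> computable K h ?N"
      by (auto intro: computable_self[OF K])
    \<comment> \<open>The Fredkin gate is an involution, so the same selection recovers
      \<open>?Y\<close> and \<open>?Z\<close>.\<close>
    have "?Y = (\<lambda>d. if ?X d = 1 then ?Z' d else ?Y' d)" by auto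
    also have "\<dots> \<in> computable K h ?N" by (rule computable_if[OF K gens(1,3,2)])
    finally show "?Y \<in> computable K h ?N" .
    have "?Z = (\<lambda>d. if ?X d = 1 then ?Y' d else ?Z' d)" by auto
    also have "\<dots> \<in> computable K h ?N" by (rule computable_if[OF K gens])
    finally show "?Z \<in> computable K h ?N" .
  qed (auto intro: computable_self[OF K])
  \<comment> \<open>These are the only inputs that the Fredkin gate moves: \<open>?X\<close> is 1
    and the other two bits differ. \<open>Y\<^sub>1\<close> and \<open>Z\<^sub>1\<close> are the
    wires after the exchange at \<open>?p\<close> alone.\<close>
  let ?p = "(1, 0, 1) :: bit \<times> bit \<times> bit" and ?q = "(1, 1, 0) :: bit \<times> bit \<times> bit"
  define Y\<^sub>1 Z\<^sub>1 where "Y\<^sub>1 = ?Y(?p := 1)" and "Z\<^sub>1 = ?Z(?p := 0)"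
  have p: "?Y(?p := 0) = ?Y" "?Z(?p := 1) = ?Z" by (simp_all add: fun_upd_idem)
  have q: "Y\<^sub>1(?q := 1) = Y\<^sub>1" "Z\<^sub>1(?q := 0) = Z\<^sub>1" "Y\<^sub>1(?q := 0) = ?Y'" "Z\<^sub>1(?q := 1) = ?Z'"
    by (auto simp: Y\<^sub>1_def Z\<^sub>1_def fun_upd_idem)
  have "{#Y\<^sub>1, Z\<^sub>1#} \<approx>\<^sub>s {#?Y, ?Z#}"
    using exchange[of ?Y ?p ?Z] by (simp only: p Y\<^sub>1_def Z\<^sub>1_def)
  moreover have "{#Y\<^sub>1, Z\<^sub>1#} \<approx>\<^sub>s {#?Y', ?Z'#}"
    using exchange[of Y\<^sub>1 ?q Z\<^sub>1] by (simp only: q)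
  ultimately have "{#?Y, ?Z#} \<approx>\<^sub>s {#?Y', ?Z'#}"
    using stable_eqv_trans stable_eqv_sym by blast
  then have "{#?X#} + {#?Y, ?Z#} \<approx>\<^sub>s {#?X#} + {#?Y', ?Z'#}"
    by (rule stable_eqv_union[OF stable_eqvI[OF eqv.refl]])
  then have "?M \<approx>\<^sub>s ?N" by (simp only: union_mset_add_mset_left add_0)
  \<comment> \<open>Both sides compute every function, so the catalyst hidden in
    \<open>\<approx>\<^sub>s\<close> can be removed.\<close>
  then have "?M \<approx> ?N" unfolding stable_eqv_def using eqv_cancel_complete[OF K M N] by blast
  moreover have "\<exists>d. map (\<lambda>f. f d) [?X, ?Y, ?Z] = x \<and> map (\<lambda>f. f d) [?X, ?Y', ?Z'] = fredkin x"
    if x: "length x = 3" for x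
  proof -
    obtain a b c where "x = [a, b, c]"
      using x by (auto simp: numeral_3_eq_3 length_Suc_conv)
    then show ?thesis by (intro exI[of _ "(a, b, c)"]) auto
  qed
  ultimately show ?thesis
    by (intro generated_of_eqv[OF reversible_fredkin, of "[?X, ?Y, ?Z]" "[?X, ?Y', ?Z']"]) simp_all
qed

end

theorem corollary59:
  fixes n :: nat and G :: "bit list \<Rightarrow> bit list"
  assumes "reversible n G" and "\<not> affine_gate n G"
  shows "(3, fredkin) \<in> generated {(n, G)}"
proof -
  interpret nonaffine_gate n G
    using assms by unfold_locales
  show ?thesis by (rule fredkin_generated)
qed

end
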